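(* Let $\gamma=\{\gamma_n\}_{n=0}^\infty$ be a sequence of positive real numbers. Then $\gamma$ preserves the set of sign-independently real-rooted polynomials (that is, $T_\gamma[f]$ is sign-independently real-rooted whenever $f$ is) if and only if $\gamma$ is log-concave.
   Context: For a sequence $\gamma=\{\gamma_n\}_{n=0}^\infty$ of real numbers, $T_\gamma\colon\mathbb{R}[z]\to\mathbb{R}[z]$ denotes the linear operator with $T_\gamma[z^n]=\gamma_n z^n$ for all $n\ge 0$. A real polynomial is real-rooted if all its complex zeros are real. A real polynomial $f(z)=\sum_{n=0}^d a_n z^n$ is sign-independently real-rooted if every polynomial obtained by arbitrary sign changes of its coefficients, i.e. every $\sum_{n=0}^d \varepsilon_n a_n z^n$ with $\varepsilon_n\in\{1,-1\}$, is real-rooted. The paper's standing convention is that the polynomials considered have coefficients $a_n\ge 0$; since sign-independent real-rootedness depends only on the moduli $|a_n|$, and $\gamma_n>0$, this entails no loss of generality. A positive sequence $\gamma$ is log-concave if $\gamma_n^2\ge\gamma_{n-1}\gamma_{n+1}$ for all $n\ge 1$. *)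

theory Defs
  imports Complex_Main "HOL-Computational_Algebra.Polynomial"
begin

definition real_rooted :: "real poly \<Rightarrow> bool" where
  "real_rooted f \<longleftrightarrow> (\<forall>z::complex. poly (map_poly complex_of_real f) z = 0 \<longrightarrow> z \<in> \<real>)"

text \<open>
  The lemmas below confirm that \<open>diag_op \<gamma>\<close> is the unique
  linear operator on the real polynomials that sends \<open>z ^ n\<close> to \<open>\<gamma> n * z ^ n\<close>.
\<close>

definition diag_op :: "(nat \<Rightarrow> real) \<Rightarrow> real poly \<Rightarrow> real poly" where
  "diag_op \<gamma> f = (\<Sum>n\<le>degree f. monom (\<gamma> n * coeff f n) n)"

lemma coeff_diag_op [simp]: "coeff (diag_op \<gamma> f) n = \<gamma> n * coeff f n"
  by (auto simp: diag_op_def coeff_sum coeff_eq_0 not_le)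

lemma diag_op_add: "diag_op \<gamma> (f + g) = diag_op \<gamma> f + diag_op \<gamma> g"
  by (simp add: poly_eq_iff algebra_simps)

lemma diag_op_smult: "diag_op \<gamma> (smult c f) = smult c (diag_op \<gamma> f)"
  by (simp add: poly_eq_iff)

lemma diag_op_monom: "diag_op \<gamma> (monom 1 n) = smult (\<gamma> n) (monom 1 n)"
  by (simp add: poly_eq_iff)

lemma diag_op_unique:
  assumes add: "\<And>f g. L (f + g) = L f + L g"
    and smult: "\<And>c f. L (smult c f) = smult c (L f)"
    and monom: "\<And>n. L (monom 1 n) = smult (\<gamma> n) (monom 1 n)"
  shows "L = diag_op \<gamma>"
proof
  fix f :: "real poly"
  have zero: "L 0 = 0"
    using smult[of 0 0] by simp
  have sum: "L (\<Sum>n\<in>A. g n) = (\<Sum>n\<in>A. L (g n))" if "finite A" for g :: "nat \<Rightarrow> real poly" and A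
    using that by (induction A) (simp_all add: zero add)
  have L_monom: "L (monom a n) = monom (\<gamma> n * a) n" for a n
    using smult[of a "monom 1 n"] monom[of n] by (simp add: smult_monom mult.commute)
  have "L f = L (\<Sum>n\<le>degree f. monom (coeff f n) n)"
    by (simp add: poly_as_sum_of_monoms)
  also have "\<dots> = diag_op \<gamma> f"
    by (simp add: sum L_monom diag_op_def)
  finally show "L f = diag_op \<gamma> f" .
qed

definition sign_independently_real_rooted :: "real poly \<Rightarrow> bool" where
  "sign_independently_real_rooted f \<longleftrightarrow>
     (\<forall>\<epsilon>::nat \<Rightarrow> real. (\<forall>n. \<epsilon> n \<in> {1, -1}) \<longrightarrow>
        real_rooted (\<Sum>n\<le>degree f. monom (\<epsilon> n * coeff f n) n))"

definition log_concave :: "(nat \<Rightarrow> real) \<Rightarrow> bool" where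
  "log_concave \<gamma> \<longleftrightarrow> (\<forall>n\<ge>1. (\<gamma> n)\<^sup>2 \<ge> \<gamma> (n - 1) * \<gamma> (n + 1))"

end

theory Submission
  imports Defs "HOL-Computational_Algebra.Fundamental_Theorem_Algebra"
begin

text \<open>
  Let \<open>f\<close> be sign-independently real-rooted. Making the \<open>k\<close>-th coefficient negative and all others
  nonnegative gives a real-rooted polynomial with a negative coefficient, so it cannot be positive on
  the whole positive half-line (else it would be a product of factors \<open>z + r\<close> with \<open>r \<ge> 0\<close>). Hence
  the \<open>k\<close>-th term of \<open>f\<close> dominates the sum of the moduli of the others at some \<open>x > 0\<close>. Conversely,
  strict domination by every term in turn forces \<open>degree f\<close> real zeros, through sign changes on the
  positive or negative half-line. A log-concave sequence lies below a geometric progression touching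
  it at \<open>k\<close>, so multiplication by it preserves domination after rescaling \<open>x\<close>; the factor \<open>q^(n^2)\<close>
  with \<open>q < 1\<close> makes domination strict, and \<open>q \<rightarrow> 1\<close> is harmless because real-rooted polynomials of
  fixed degree satisfy a lower bound off the real axis. Necessity of log-concavity is the
  discriminant of the image of \<open>z^k (1 + z)^2\<close>.
\<close>

section \<open>Real-rooted polynomials: linear factors, lower bounds, coefficient signs\<close>

lemma map_poly_of_real_mult:
  "map_poly complex_of_real (p * q) = map_poly of_real p * map_poly of_real q"
  by (simp add: poly_eq_iff coeff_map_poly coeff_mult)

lemma poly_map_of_real_of_real [simp]:
  "poly (map_poly complex_of_real p) (of_real x) = of_real (poly p x)"
  by (induction p) (auto simp: map_poly_pCons)

lemma poly_map_of_real_altdef: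
  "poly (map_poly complex_of_real p) z = (\<Sum>n\<le>degree p. of_real (coeff p n) * z ^ n)"
  by (simp add: poly_altdef coeff_map_poly degree_map_poly)

lemma real_rooted_mult_iff: "real_rooted (p * q) \<longleftrightarrow> real_rooted p \<and> real_rooted q"
  by (auto simp: real_rooted_def map_poly_of_real_mult)

text \<open>The zero polynomial vanishes at the imaginary unit, so \<open>real_rooted\<close>
  excludes it.\<close>

lemma real_rooted_nonzero: "real_rooted f \<Longrightarrow> f \<noteq> 0"
  by (auto simp: real_rooted_def complex_is_Real_iff dest: spec[of _ \<i>])

text \<open>By the fundamental theorem of algebra a nonconstant \<open>f\<close> has a complex zero;
  being real, it splits off as a linear factor over the reals.\<close>

lemma real_rooted_induct [consumes 1, case_names const mult]:
  assumes "real_rooted f"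
    and const: "\<And>c. c \<noteq> 0 \<Longrightarrow> P [:c:]"
    and mult: "\<And>r g. real_rooted g \<Longrightarrow> P g \<Longrightarrow> P ([:-r, 1:] * g)"
  shows "P f"
  using assms(1)
proof (induction "degree f" arbitrary: f)
  case 0
  then show ?case
    using const real_rooted_nonzero by (metis degree_eq_zeroE pCons_0_0)
next
  case (Suc n)
  have "\<not> constant (poly (map_poly complex_of_real f))"
    using Suc.hyps(2) by (simp add: constant_degree degree_map_poly)
  then obtain z where z: "poly (map_poly complex_of_real f) z = 0"
    using fundamental_theorem_of_algebra by blast
  with Suc.prems obtain r where "z = of_real r"
    by (auto simp: real_rooted_def elim: Reals_cases)
  with z have "poly f r = 0"
    by simp
  then obtain g where g: "f = [:-r, 1:] * g"
    by (auto simp: poly_eq_0_iff_dvd)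
  with Suc.prems have rr: "real_rooted g"
    by (simp only: real_rooted_mult_iff)
  have "degree f = Suc (degree g)"
    using real_rooted_nonzero[OF rr] unfolding g by (subst degree_mult_eq) auto
  with Suc.hyps rr have "P g" by simp
  then show ?case
    unfolding g by (rule mult[OF rr])
qed

text \<open>Each factor \<open>z - r\<close> with \<open>r\<close> real has modulus at least
  \<open>\<bar>Im z\<bar>\<close>. This quantitative form of real-rootedness survives limits of the
  coefficients at fixed degree.\<close>

lemma real_rooted_norm_ge:
  assumes "real_rooted f"
  shows "\<bar>lead_coeff f\<bar> * \<bar>Im z\<bar> ^ degree f \<le> norm (poly (map_poly complex_of_real f) z)"
  using assms
proof (induction rule: real_rooted_induct)
  case (const c)
  then show ?case by (simp add: map_poly_pCons)
next
  case (mult r g)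
  have deg: "degree ([:-r, 1:] * g) = Suc (degree g)"
    using real_rooted_nonzero[OF mult(1)] by (subst degree_mult_eq) auto
  have "\<bar>Im z\<bar> \<le> norm (z - of_real r)"
    using abs_Im_le_cmod[of "z - of_real r"] by simp
  then have "\<bar>Im z\<bar> * (\<bar>lead_coeff g\<bar> * \<bar>Im z\<bar> ^ degree g)
      \<le> norm (z - of_real r) * norm (poly (map_poly complex_of_real g) z)"
    using mult(2) by (intro mult_mono) auto
  moreover have "poly (map_poly complex_of_real ([:-r, 1:] * g)) z
      = (z - of_real r) * poly (map_poly complex_of_real g) z"
    unfolding map_poly_of_real_mult by (simp add: map_poly_pCons algebra_simps)
  moreover have "coeff ([:-r, 1:] * g) (Suc (degree g)) = lead_coeff g"
    using lead_coeff_mult[of "[:-r, 1:]" g] unfolding deg by simp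
  ultimately show ?case
    unfolding deg by (simp only: norm_mult power_Suc mult.left_commute)
qed

text \<open>Positivity rules out positive zeros, so \<open>f\<close> is a positive constant times
  factors \<open>z - r\<close> with \<open>r \<le> 0\<close>. Multiplying by such a factor keeps the
  coefficients nonnegative and keeps their support free of gaps up to the degree.\<close>

lemma real_rooted_pos_coeff:
  assumes "real_rooted f" and "\<And>x. x > 0 \<Longrightarrow> poly f x > 0"
  shows "coeff f n \<ge> 0" and "coeff f j \<noteq> 0 \<Longrightarrow> j \<le> k \<Longrightarrow> k \<le> degree f \<Longrightarrow> coeff f k > 0"
proof -
  have "(\<forall>n. coeff f n \<ge> 0) \<and> (\<forall>j k. coeff f j \<noteq> 0 \<longrightarrow> j \<le> k \<longrightarrow> k \<le> degree f \<longrightarrow> coeff f k > 0)"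
    using assms
  proof (induction rule: real_rooted_induct)
    case (const c)
    from const(2)[of 1] show ?case
      by (auto simp: coeff_pCons split: nat.splits)
  next
    case (mult r g)
    \<comment> \<open>A positive \<open>r\<close> would be a zero of the product on the positive
      half-line.\<close>
    have r: "r \<le> 0"
      using mult(3)[of r] by fastforce
    have "poly g x > 0" if "x > 0" for x
      using mult(3)[OF that] r that by (simp add: zero_less_mult_iff algebra_simps)
        (smt (verit) mult_less_cancel_right)
    with mult(2) have nonneg: "coeff g n \<ge> 0"
      and pos: "coeff g j \<noteq> 0 \<Longrightarrow> j \<le> k \<Longrightarrow> k \<le> degree g \<Longrightarrow> coeff g k > 0" for n j k
      by auto
    have deg: "degree ([:-r, 1:] * g) = Suc (degree g)"
      using real_rooted_nonzero[OF mult(1)] by (subst degree_mult_eq) auto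
    have coeff: "coeff ([:-r, 1:] * g) n = (if n = 0 then 0 else coeff g (n - 1)) + (-r) * coeff g n" for n
      by (cases n) auto
    have lead: "coeff g (degree g) > 0"
      using pos[of "degree g" "degree g"] real_rooted_nonzero[OF mult(1)] by simp
    have "coeff ([:-r, 1:] * g) k > 0"
      if j: "coeff ([:-r, 1:] * g) j \<noteq> 0" and "j \<le> k" "k \<le> Suc (degree g)" for j k
    proof -
      have "(j \<noteq> 0 \<and> coeff g (j - 1) \<noteq> 0) \<or> (r < 0 \<and> coeff g j \<noteq> 0)"
        using j r unfolding coeff by (auto split: if_splits)
      then have "(k \<noteq> 0 \<and> coeff g (k - 1) > 0) \<or> (r < 0 \<and> coeff g k > 0)"
      proof (elim disjE conjE)
        assume "j \<noteq> 0" "coeff g (j - 1) \<noteq> 0"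
        then show ?thesis using pos[of "j - 1" "k - 1"] that by auto
      next
        assume "r < 0" "coeff g j \<noteq> 0"
        \<comment> \<open>For \<open>k = Suc (degree g)\<close> the first alternative holds, because
          \<open>coeff g (k - 1)\<close> is then the leading coefficient of
          \<open>g\<close>.\<close>
        then show ?thesis using pos[of j k] that lead by (cases "k \<le> degree g") (auto simp: le_Suc_eq)
      qed
      then show ?thesis
        unfolding coeff using nonneg[of k] nonneg[of "k - 1"] r
        by (auto intro: add_nonneg_pos add_pos_nonneg mult_pos_pos
            simp: mult_nonpos_nonneg mult_neg_pos simp del: mult_minus_left)
    qed
    moreover have "coeff ([:-r, 1:] * g) n \<ge> 0" for n
      unfolding coeff using nonneg[of n] nonneg[of "n - 1"] mult_nonpos_nonneg[OF r, of "coeff g n"] by auto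
    ultimately show ?case
      unfolding deg by blast
  qed
  then show "coeff f n \<ge> 0" "coeff f j \<noteq> 0 \<Longrightarrow> j \<le> k \<Longrightarrow> k \<le> degree f \<Longrightarrow> coeff f k > 0"
    by blast+
qed

section \<open>Consequences of sign-independent real-rootedness for the coefficients\<close>

lemma sign_independently_real_rooted_alt:
  "sign_independently_real_rooted f \<longleftrightarrow>
     (\<forall>\<epsilon>. (\<forall>n. \<epsilon> n \<in> {1, -1}) \<longrightarrow> real_rooted (diag_op \<epsilon> f))"
  by (simp add: sign_independently_real_rooted_def diag_op_def)

lemma degree_diag_op: "(\<And>n. \<gamma> n \<noteq> 0) \<Longrightarrow> degree (diag_op \<gamma> f) = degree f"
  by (intro antisym degree_le) (auto simp: coeff_eq_0 intro!: le_degree degree_le dest: coeff_eq_0)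

lemma diag_op_diag_op: "diag_op \<gamma> (diag_op \<delta> f) = diag_op (\<lambda>n. \<gamma> n * \<delta> n) f"
  by (simp add: poly_eq_iff)

text \<open>The second factor turns the coefficients into their moduli, so that \<open>s\<close>
  alone determines the signs of the nonzero coefficients of the result.\<close>

lemma sign_independently_real_rooted_abs:
  assumes "sign_independently_real_rooted f" and "\<And>n. s n \<in> {1, -1}"
  shows "real_rooted (diag_op (\<lambda>n. s n * (if coeff f n < 0 then -1 else 1)) f)"
proof -
  have "s n * (if coeff f n < 0 then -1 else 1) \<in> {1, -1}" for n
    using assms(2)[of n] by auto
  then show ?thesis
    using assms(1) unfolding sign_independently_real_rooted_alt by simp
qed

text \<open>With coefficients replaced by their moduli, the polynomial is positive on the positive
  half-line and real-rooted, so its support has no gaps. Hence every index from the order of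
  vanishing at 0 up to the degree can be made dominant.\<close>

lemma sign_independently_real_rooted_coeff_nonzero:
  assumes "sign_independently_real_rooted f" and "coeff f j \<noteq> 0" "j \<le> k" "k \<le> degree f"
  shows "coeff f k \<noteq> 0"
proof -
  define s where "s = (\<lambda>n. 1 * (if coeff f n < 0 then -1 else 1 :: real))"
  have deg: "degree (diag_op s f) = degree f"
    by (rule degree_diag_op) (auto simp: s_def)
  have coeff: "s n * coeff f n = \<bar>coeff f n\<bar>" for n
    by (simp add: s_def)
  have "poly (diag_op s f) x > 0" if "x > 0" for x
  proof -
    have "poly (diag_op s f) x = (\<Sum>n\<le>degree f. \<bar>coeff f n\<bar> * x ^ n)"
      by (simp add: poly_altdef deg coeff)
    also have "\<dots> > 0"
      using assms that by (intro sum_pos2[of _ j]) auto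
    finally show ?thesis .
  qed
  moreover have "real_rooted (diag_op s f)"
    unfolding s_def by (rule sign_independently_real_rooted_abs[OF assms(1)]) auto
  ultimately show ?thesis
    using real_rooted_pos_coeff(2)[of "diag_op s f" j k] assms deg coeff[of j] coeff[of k] by auto
qed

text \<open>Otherwise the moduli with only the \<open>k\<close>-th sign flipped would give a
  real-rooted polynomial that is positive on the positive half-line but has a negative coefficient.
  Only weak domination can be expected: for \<open>(1 + z)^2\<close> and \<open>k = 1\<close> it
  holds at \<open>x = 1\<close> alone, with equality.\<close>

lemma sign_independently_real_rooted_dominant:
  assumes "sign_independently_real_rooted f" and "coeff f k \<noteq> 0"
  shows "\<exists>x>0. (\<Sum>n\<in>{..degree f} - {k}. \<bar>coeff f n\<bar> * x ^ n) \<le> \<bar>coeff f k\<bar> * x ^ k"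
proof (rule ccontr)
  assume contra: "\<not> ?thesis"
  define s where "s = (\<lambda>n. (if n = k then -1 else 1) * (if coeff f n < 0 then -1 else 1 :: real))"
  have deg: "degree (diag_op s f) = degree f"
    by (rule degree_diag_op) (auto simp: s_def)
  have k: "k \<le> degree f"
    using assms(2) by (rule le_degree)
  have coeff: "s n * coeff f n = (if n = k then -1 else 1) * \<bar>coeff f n\<bar>" for n
    by (simp add: s_def)
  have "poly (diag_op s f) x > 0" if "x > 0" for x
  proof -
    have "poly (diag_op s f) x = (\<Sum>n\<le>degree f. (if n = k then -1 else 1) * \<bar>coeff f n\<bar> * x ^ n)"
      by (simp add: poly_altdef deg coeff)
    also have "\<dots> = - \<bar>coeff f k\<bar> * x ^ k + (\<Sum>n\<in>{..degree f} - {k}. \<bar>coeff f n\<bar> * x ^ n)"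
      using k by (subst sum.remove[of _ k]) (auto intro!: sum.cong)
    also have "\<dots> > 0"
      using contra that by (auto simp: not_le)
    finally show ?thesis .
  qed
  moreover have "real_rooted (diag_op s f)"
    unfolding s_def by (rule sign_independently_real_rooted_abs[OF assms(1)]) auto
  ultimately have "coeff (diag_op s f) k \<ge> 0"
    using real_rooted_pos_coeff(1) by blast
  then show False
    using assms(2) coeff[of k] by simp
qed

section \<open>Real zeros from dominant terms\<close>

lemma sgn_poly_dominant:
  fixes f :: "real poly"
  assumes "(\<Sum>n\<in>{..degree f} - {k}. \<bar>coeff f n\<bar> * \<bar>t\<bar> ^ n) < \<bar>coeff f k\<bar> * \<bar>t\<bar> ^ k"
  shows "sgn (poly f t) = sgn (coeff f k * t ^ k)"
proof -
  have "coeff f k \<noteq> 0"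
    using assms sum_nonneg[of "{..degree f} - {k}" "\<lambda>n. \<bar>coeff f n\<bar> * \<bar>t\<bar> ^ n"] by auto
  then have "k \<le> degree f"
    by (rule le_degree)
  then have "poly f t = coeff f k * t ^ k + (\<Sum>n\<in>{..degree f} - {k}. coeff f n * t ^ n)"
    by (simp add: poly_altdef sum.remove)
  moreover have "\<bar>\<Sum>n\<in>{..degree f} - {k}. coeff f n * t ^ n\<bar> \<le> (\<Sum>n\<in>{..degree f} - {k}. \<bar>coeff f n\<bar> * \<bar>t\<bar> ^ n)"
    by (rule order.trans[OF sum_abs]) (simp add: abs_mult power_abs)
  ultimately have "\<bar>poly f t - coeff f k * t ^ k\<bar> < \<bar>coeff f k * t ^ k\<bar>"
    using assms by (simp add: abs_mult power_abs)
  moreover have "sgn a = sgn b" if "\<bar>a - b\<bar> < \<bar>b\<bar>" for a b :: real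
    using that by (auto simp: sgn_if)
  ultimately show ?thesis
    by blast
qed

text \<open>Comparing only the terms \<open>k\<close> and \<open>Suc k\<close> puts the quotient of
  their coefficient moduli strictly between \<open>x\<close> and \<open>y\<close>. The zero comes
  from a sign change on the half-line where the two dominant terms have opposite signs.\<close>

lemma dominant_terms_imp_root:
  fixes f :: "real poly"
  assumes pos: "x > 0" "y > 0"
    and x: "(\<Sum>n\<in>{..degree f} - {k}. \<bar>coeff f n\<bar> * x ^ n) < \<bar>coeff f k\<bar> * x ^ k"
    and y: "(\<Sum>n\<in>{..degree f} - {Suc k}. \<bar>coeff f n\<bar> * y ^ n) < \<bar>coeff f (Suc k)\<bar> * y ^ Suc k"
  shows "x < y" and "\<exists>t. x < \<bar>t\<bar> \<and> \<bar>t\<bar> < y \<and> poly f t = 0"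
proof -
  have nz: "coeff f k \<noteq> 0" "coeff f (Suc k) \<noteq> 0"
    using x y pos sum_nonneg[of "{..degree f} - {k}" "\<lambda>n. \<bar>coeff f n\<bar> * x ^ n"]
      sum_nonneg[of "{..degree f} - {Suc k}" "\<lambda>n. \<bar>coeff f n\<bar> * y ^ n"] by auto
  have deg: "Suc k \<le> degree f"
    using nz(2) by (rule le_degree)
  have "\<bar>coeff f (Suc k)\<bar> * x ^ Suc k \<le> (\<Sum>n\<in>{..degree f} - {k}. \<bar>coeff f n\<bar> * x ^ n)"
    using deg pos by (intro member_le_sum) auto
  with x have "(\<bar>coeff f (Suc k)\<bar> * x) * x ^ k < \<bar>coeff f k\<bar> * x ^ k"
    by (simp add: mult_ac)
  then have 1: "\<bar>coeff f (Suc k)\<bar> * x < \<bar>coeff f k\<bar>"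
    using pos by simp
  have "\<bar>coeff f k\<bar> * y ^ k \<le> (\<Sum>n\<in>{..degree f} - {Suc k}. \<bar>coeff f n\<bar> * y ^ n)"
    using deg pos by (intro member_le_sum) auto
  with y have "\<bar>coeff f k\<bar> * y ^ k < (\<bar>coeff f (Suc k)\<bar> * y) * y ^ k"
    by (simp add: mult_ac)
  then have 2: "\<bar>coeff f k\<bar> < \<bar>coeff f (Suc k)\<bar> * y"
    using pos by simp
  from 1 2 have "\<bar>coeff f (Suc k)\<bar> * x < \<bar>coeff f (Suc k)\<bar> * y"
    by linarith
  then show xy: "x < y"
    using nz by simp
  \<comment> \<open>The product of the dominant terms at \<open>s * x\<close> and
    \<open>s * y\<close> carries the odd power \<open>s ^ (2 * k + 1)\<close>, which equals
    \<open>s\<close>; this choice makes the product negative.\<close>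
  define s where "s = - sgn (coeff f k * coeff f (Suc k))"
  have s: "s * s = 1" "\<bar>s\<bar> = 1"
    using nz by (auto simp: s_def sgn_if)
  have "sgn (poly f (s * x)) = sgn (coeff f k * (s * x) ^ k)"
    using x pos s by (intro sgn_poly_dominant) (simp add: abs_mult)
  moreover have "sgn (poly f (s * y)) = sgn (coeff f (Suc k) * (s * y) ^ Suc k)"
    using y pos s by (intro sgn_poly_dominant) (simp add: abs_mult)
  ultimately have "sgn (poly f (s * x) * poly f (s * y))
      = sgn ((s ^ k * s ^ k * s) * (coeff f k * coeff f (Suc k)) * (x ^ k * y ^ Suc k))"
    by (simp add: sgn_mult power_mult_distrib mult_ac)
  also have "s ^ k * s ^ k = 1"
    using s by (simp add: power_mult_distrib[symmetric])
  also have "sgn (1 * s * (coeff f k * coeff f (Suc k)) * (x ^ k * y ^ Suc k)) = -1"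
    using nz pos by (simp add: s_def sgn_mult) (auto simp: sgn_if)
  finally have "poly f (s * x) * poly f (s * y) < 0"
    by (simp only: sgn_1_neg)
  \<comment> \<open>Substituting \<open>s * z\<close> for \<open>z\<close> moves the sign change to
    the interval from \<open>x\<close> to \<open>y\<close>, whichever half-line \<open>s\<close>
    selects.\<close>
  then have "poly (pcompose f [:0, s:]) x * poly (pcompose f [:0, s:]) y < 0"
    by (simp add: poly_pcompose mult.commute)
  then obtain u where "x < u" "u < y" "poly (pcompose f [:0, s:]) u = 0"
    using poly_IVT[OF xy] by blast
  then show "\<exists>t. x < \<bar>t\<bar> \<and> \<bar>t\<bar> < y \<and> poly f t = 0"
    using pos s by (intro exI[of _ "s * u"]) (auto simp: poly_pcompose abs_mult mult.commute)
qed

text \<open>Consecutive dominant indices yield \<open>degree f - m\<close> nonzero real zeros with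
  distinct moduli, separated by the points of domination. Once \<open>z ^ m\<close> is split off,
  they exhaust the degree.\<close>

lemma dominant_terms_imp_real_rooted:
  fixes f :: "real poly"
  assumes "f \<noteq> 0" and low: "\<And>n. n < m \<Longrightarrow> coeff f n = 0"
    and dom: "\<And>k. m \<le> k \<Longrightarrow> k \<le> degree f \<Longrightarrow>
      \<exists>x>0. (\<Sum>n\<in>{..degree f} - {k}. \<bar>coeff f n\<bar> * x ^ n) < \<bar>coeff f k\<bar> * x ^ k"
  shows "real_rooted f"
proof -
  define d where "d = degree f"
  obtain x where x_pos: "\<And>k. m \<le> k \<Longrightarrow> k \<le> d \<Longrightarrow> x k > 0"
    and x: "\<And>k. m \<le> k \<Longrightarrow> k \<le> d \<Longrightarrow>
      (\<Sum>n\<in>{..degree f} - {k}. \<bar>coeff f n\<bar> * x k ^ n) < \<bar>coeff f k\<bar> * x k ^ k"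
    using dom unfolding d_def by metis
  have mono: "x k < x (Suc k)"
    and "\<exists>t. x k < \<bar>t\<bar> \<and> \<bar>t\<bar> < x (Suc k) \<and> poly f t = 0" if "m \<le> k" "k < d" for k
    using dominant_terms_imp_root[OF x_pos x_pos x x, of k] that by simp_all
  then obtain y where y: "\<And>k. m \<le> k \<Longrightarrow> k < d \<Longrightarrow> x k < \<bar>y k\<bar> \<and> \<bar>y k\<bar> < x (Suc k) \<and> poly f (y k) = 0"
    by metis
  have mono': "x i \<le> x j" if "i \<le> j" "m \<le> i" "j \<le> d" for i j
    using that
  proof (induction j rule: dec_induct)
    case (step j)
    then show ?case using mono[of j] by force
  qed simp
  have less: "\<bar>y i\<bar> < \<bar>y j\<bar>" if "m \<le> i" "i < j" "j < d" for i j
    using y[of i] y[of j] mono'[of "Suc i" j] that by force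
  have inj: "inj_on y {m..<d}"
    by (rule inj_onI) (metis atLeastLessThan_iff less less_irrefl linorder_neqE_nat)
  define F where "F = map_poly complex_of_real f"
  have "monom 1 m dvd F"
    unfolding F_def using low by (auto simp: monom_1_dvd_iff' coeff_map_poly)
  then obtain G where G: "F = monom 1 m * G"
    by (auto elim: dvdE)
  have "F \<noteq> 0"
    using \<open>f \<noteq> 0\<close> by (simp add: F_def map_poly_eq_0_iff)
  then have "G \<noteq> 0"
    using G by auto
  have "d = m + degree G"
    using \<open>G \<noteq> 0\<close> degree_mult_eq[of "monom 1 m" G] unfolding G[symmetric]
    by (simp add: F_def d_def degree_map_poly degree_monom_eq)
  define Z where "Z = complex_of_real ` y ` {m..<d}"
  \<comment> \<open>\<open>G\<close> has degree \<open>d - m\<close>, so the \<open>d - m\<close>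
    distinct elements of \<open>Z\<close> leave no room for other zeros.\<close>
  have "Z = {z. poly G z = 0}"
  proof (rule card_seteq)
    show "finite {z. poly G z = 0}"
      using \<open>G \<noteq> 0\<close> by (rule poly_roots_finite)
    show "Z \<subseteq> {z. poly G z = 0}"
    proof (clarsimp simp: Z_def)
      fix k assume k: "m \<le> k" "k < d"
      then have "poly F (of_real (y k)) = 0" "y k \<noteq> 0"
        using y[of k] x_pos[of k] by (auto simp: F_def)
      then show "poly G (of_real (y k)) = 0"
        by (simp add: G poly_monom)
    qed
    have "card {z. poly G z = 0} \<le> degree G"
      using \<open>G \<noteq> 0\<close> by (rule card_poly_roots_bound)
    also have "degree G = card Z"
      unfolding Z_def using inj \<open>d = m + degree G\<close> by (simp add: card_image inj_on_def)
    finally show "card {z. poly G z = 0} \<le> card Z" .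
  qed
  moreover have "Z \<subseteq> \<real>"
    by (auto simp: Z_def)
  ultimately have "z \<in> \<real>" if "poly F z = 0" for z
    using that by (cases "z = 0") (auto simp: G poly_monom)
  then show ?thesis
    by (simp add: real_rooted_def F_def)
qed

section \<open>Passage to the limit \<open>q \<rightarrow> 1\<close>\<close>

text \<open>At a nonreal zero of \<open>f\<close> the values of the perturbed polynomials tend to 0,
  while the lower bound of \<open>real_rooted_norm_ge\<close> tends to a positive number, since the
  factors \<open>q ^ e n\<close> leave the degree unchanged.\<close>

lemma real_rooted_limit:
  fixes f :: "real poly"
  assumes "f \<noteq> 0"
    and rr: "\<And>q. 0 < q \<Longrightarrow> q < 1 \<Longrightarrow> real_rooted (diag_op (\<lambda>n. q ^ e n) f)"
  shows "real_rooted f"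
  unfolding real_rooted_def
proof (intro allI impI, rule ccontr)
  fix z assume z: "poly (map_poly complex_of_real f) z = 0" "z \<notin> \<real>"
  define d where "d = degree f"
  define L where "L = (\<lambda>q. \<bar>q ^ e d * coeff f d\<bar> * \<bar>Im z\<bar> ^ d)"
  define R where "R = (\<lambda>q::real. norm (\<Sum>n\<le>d. of_real (q ^ e n * coeff f n) * z ^ n))"
  have "L q \<le> R q" if "0 < q" "q < 1" for q
  proof -
    have deg: "degree (diag_op (\<lambda>n. q ^ e n) f) = d"
      unfolding d_def by (rule degree_diag_op) (use that in auto)
    show ?thesis
      using real_rooted_norm_ge[OF rr[OF that], of z]
      by (simp add: L_def R_def poly_map_of_real_altdef deg)
  qed
  then have "\<forall>\<^sub>F q in at_left 1. L q \<le> R q"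
    using eventually_at_left_real[of 0 "1::real"] by (auto elim!: eventually_mono)
  moreover have "(L \<longlongrightarrow> L 1) (at_left 1)" "(R \<longlongrightarrow> R 1) (at_left 1)"
    unfolding L_def R_def by (intro tendsto_intros)+
  ultimately have "L 1 \<le> R 1"
    by (intro tendsto_le[OF _ _ _]) auto
  also have "R 1 = 0"
    using z by (simp add: R_def d_def poly_map_of_real_altdef)
  finally have "L 1 \<le> 0" .
  moreover have "L 1 > 0"
    using z(2) \<open>f \<noteq> 0\<close> by (simp add: L_def d_def complex_is_Real_iff)
  ultimately show False
    by simp
qed

section \<open>Log-concave sequences and geometric majorants\<close>

text \<open>This is a supporting line at \<open>k\<close> of the concave sequence
  \<open>ln (\<gamma> n)\<close>, in multiplicative form.\<close>

lemma log_concave_le_geometric: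
  assumes pos: "\<And>n. \<gamma> n > 0" and "log_concave \<gamma>"
  shows "\<exists>r>0. \<forall>n. \<gamma> n * r ^ k \<le> \<gamma> k * r ^ n"
proof -
  define \<rho> where "\<rho> = (\<lambda>n. \<gamma> (Suc n) / \<gamma> n)"
  have ratio: "\<gamma> (Suc n) = \<rho> n * \<gamma> n" and \<rho>_pos: "\<rho> n > 0" for n
    using pos[of n] pos[of "Suc n"] by (auto simp: \<rho>_def)
  have "\<rho> (Suc n) \<le> \<rho> n" for n
    using assms(2)[unfolded log_concave_def, rule_format, of "Suc n"] pos[of n] pos[of "Suc n"]
    by (simp add: \<rho>_def field_simps power2_eq_square)
  then have anti: "\<rho> n \<le> \<rho> m" if "m \<le> n" for m n
    using that by (rule lift_Suc_antimono_le)
  \<comment> \<open>The ratios decrease, so they are at most \<open>r\<close> from \<open>k\<close>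
    on and at least \<open>r\<close> before \<open>k\<close>.\<close>
  define r where "r = \<rho> k"
  have r: "r > 0"
    by (simp add: r_def \<rho>_pos)
  have "\<gamma> n * r ^ k \<le> \<gamma> k * r ^ n" for n
  proof (cases "k \<le> n")
    case True
    then show ?thesis
    proof (induction n rule: dec_induct)
      case (step n)
      have "\<gamma> (Suc n) * r ^ k = \<rho> n * (\<gamma> n * r ^ k)"
        by (simp add: ratio)
      also have "\<dots> \<le> r * (\<gamma> k * r ^ n)"
        using step.IH step.hyps anti[of k n] r pos[of n]
        by (intro mult_mono[of "\<rho> n" r "\<gamma> n * r ^ k"]) (auto simp: r_def)
      finally show ?case by (simp add: mult_ac)
    qed simp
  next
    case False
    then have "n \<le> k" by simp
    then show ?thesis
    proof (induction n rule: inc_induct)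
      case (step n)
      have "r * (\<gamma> n * r ^ k) \<le> \<rho> n * (\<gamma> n * r ^ k)"
        using step anti[of n k] r pos[of n] unfolding r_def
        by (intro mult_right_mono) (auto intro: less_imp_le)
      also have "\<dots> = \<gamma> (Suc n) * r ^ k"
        by (simp add: ratio)
      also have "\<dots> \<le> r * (\<gamma> k * r ^ n)"
        using step by (simp add: mult_ac)
      finally show ?case using r by simp
    qed simp
  qed
  with r show ?thesis by blast
qed

text \<open>The tangent to \<open>n^2\<close> at \<open>k\<close> has slope \<open>2 * k\<close>,
  whence the ratio \<open>r * q ^ (2 * k)\<close>. The gap in the exponent is
  \<open>(n - k)^2\<close>, at least 1 for integers \<open>n \<noteq> k\<close>, which gives the
  factor \<open>q\<close> uniformly in \<open>n\<close>.\<close>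

lemma log_concave_gaussian_less_geometric:
  assumes pos: "\<And>n. \<gamma> n > 0" and "log_concave \<gamma>" and q: "0 < q" "q < 1"
  shows "\<exists>r>0. \<forall>n. n \<noteq> k \<longrightarrow> (q ^ n\<^sup>2 * \<gamma> n) * r ^ k \<le> q * ((q ^ k\<^sup>2 * \<gamma> k) * r ^ n)"
proof -
  obtain r where r: "r > 0" "\<And>n. \<gamma> n * r ^ k \<le> \<gamma> k * r ^ n"
    using log_concave_le_geometric[OF assms(1,2)] by metis
  have "(q ^ n\<^sup>2 * \<gamma> n) * (r * q ^ (2 * k)) ^ k \<le> q * ((q ^ k\<^sup>2 * \<gamma> k) * (r * q ^ (2 * k)) ^ n)"
    if "n \<noteq> k" for n
  proof -
    have "(int n - int k)\<^sup>2 \<ge> 1"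
      using that by (smt (verit) of_nat_eq_iff one_le_power zero_less_power2 zle_iff_zadd)
    then have "int (n\<^sup>2 + 2 * k * k) \<ge> int (Suc (k\<^sup>2 + 2 * k * n))"
      by (simp add: power2_eq_square algebra_simps)
    then have "q ^ (n\<^sup>2 + 2 * k * k) \<le> q ^ (Suc (k\<^sup>2 + 2 * k * n))"
      using q by (intro power_decreasing) linarith+
    then have "q ^ (n\<^sup>2 + 2 * k * k) * (\<gamma> n * r ^ k) \<le> q ^ (Suc (k\<^sup>2 + 2 * k * n)) * (\<gamma> k * r ^ n)"
      using r q pos[of n] by (intro mult_mono[of _ _ "\<gamma> n * r ^ k"]) auto
    moreover have "(r * q ^ (2 * k)) ^ j = r ^ j * q ^ (2 * k * j)" for j
      by (simp only: power_mult_distrib power_mult)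
    ultimately show ?thesis
      by (simp add: power_add mult_ac)
  qed
  then show ?thesis
    using r q by (intro exI[of _ "r * q ^ (2 * k)"]) auto
qed

section \<open>Sufficiency of log-concavity\<close>

lemma log_concave_imp_preserves:
  assumes pos: "\<And>n. \<gamma> n > 0" and lc: "log_concave \<gamma>" and f: "sign_independently_real_rooted f"
  shows "sign_independently_real_rooted (diag_op \<gamma> f)"
  unfolding sign_independently_real_rooted_alt
proof (intro allI impI)
  fix \<epsilon> :: "nat \<Rightarrow> real" assume \<epsilon>: "\<forall>n. \<epsilon> n \<in> {1, -1}"
  have abs_\<epsilon>: "\<bar>\<epsilon> n\<bar> = 1" for n
    using \<epsilon>[rule_format, of n] by auto
  then have \<epsilon>_nz: "\<epsilon> n \<noteq> 0" for n
    by (metis abs_zero zero_neq_one)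
  have "real_rooted (diag_op (\<lambda>_. 1) f)"
    using f unfolding sign_independently_real_rooted_alt by simp
  moreover have "diag_op (\<lambda>_. 1) f = f"
    by (simp add: poly_eq_iff)
  ultimately have "f \<noteq> 0"
    using real_rooted_nonzero by simp
  define m where "m = (LEAST n. coeff f n \<noteq> 0)"
  have m: "coeff f m \<noteq> 0"
    unfolding m_def using \<open>f \<noteq> 0\<close> LeastI[of "\<lambda>n. coeff f n \<noteq> 0" "degree f"] by simp
  have low: "coeff f n = 0" if "n < m" for n
    using not_less_Least[of n "\<lambda>n. coeff f n \<noteq> 0"] that unfolding m_def by simp
  show "real_rooted (diag_op \<epsilon> (diag_op \<gamma> f))"
  \<comment> \<open>The weights \<open>q ^ e n\<close> with \<open>e n = n^2\<close> supply strict
    domination for each \<open>q < 1\<close>, and the limit removes them.\<close>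
  proof (rule real_rooted_limit)
    show "diag_op \<epsilon> (diag_op \<gamma> f) \<noteq> 0"
      using m \<epsilon>_nz[of m] pos[of m] by (auto simp: poly_eq_iff)
  next
    fix q :: real assume q: "0 < q" "q < 1"
    define g where "g = diag_op (\<lambda>n. q ^ n\<^sup>2) (diag_op \<epsilon> (diag_op \<gamma> f))"
    define \<delta> where "\<delta> = (\<lambda>n. q ^ n\<^sup>2 * \<gamma> n)"
    have \<delta>: "\<delta> n > 0" for n
      using q pos[of n] by (simp add: \<delta>_def)
    have deg: "degree g = degree f"
      unfolding g_def diag_op_diag_op using \<epsilon>_nz pos q
      by (intro degree_diag_op) (simp add: less_imp_neq[symmetric])
    have coeff: "\<bar>coeff g n\<bar> = \<delta> n * \<bar>coeff f n\<bar>" for n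
      using q pos[of n] abs_\<epsilon>[of n] by (simp add: g_def \<delta>_def abs_mult)
    have "real_rooted g"
    proof (rule dominant_terms_imp_real_rooted)
      show "g \<noteq> 0"
        using m coeff[of m] \<delta>[of m] by auto
      show "coeff g n = 0" if "n < m" for n
        using low[OF that] by (simp add: g_def)
      fix k assume k: "m \<le> k" "k \<le> degree g"
      have nz: "coeff f k \<noteq> 0"
        using sign_independently_real_rooted_coeff_nonzero[OF f m k(1)] k(2) deg by simp
      obtain x where x: "x > 0"
        "(\<Sum>n\<in>{..degree f} - {k}. \<bar>coeff f n\<bar> * x ^ n) \<le> \<bar>coeff f k\<bar> * x ^ k"
        using sign_independently_real_rooted_dominant[OF f nz] by blast
      obtain r where r: "r > 0" "\<And>n. n \<noteq> k \<Longrightarrow> \<delta> n * r ^ k \<le> q * (\<delta> k * r ^ n)"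
        using log_concave_gaussian_less_geometric[OF pos lc q, of k] unfolding \<delta>_def by metis
      \<comment> \<open>\<open>C\<close> is the value of \<open>\<delta> n / r ^ n\<close> at
        \<open>n = k\<close>; at every other index this quotient is at most
        \<open>q * C\<close>.\<close>
      define C where "C = \<delta> k / r ^ k"
      have C: "C > 0"
        using \<delta> r by (simp add: C_def)
      have "\<delta> n / r ^ n \<le> q * C" if "n \<noteq> k" for n
        using r(2)[OF that] r(1) by (simp add: C_def field_simps)
      then have "\<delta> n / r ^ n * (\<bar>coeff f n\<bar> * x ^ n) \<le> q * C * (\<bar>coeff f n\<bar> * x ^ n)" if "n \<noteq> k" for n
        using that x(1) by (intro mult_right_mono) auto
      then have "(\<Sum>n\<in>{..degree f} - {k}. \<delta> n / r ^ n * (\<bar>coeff f n\<bar> * x ^ n))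
          \<le> (\<Sum>n\<in>{..degree f} - {k}. q * C * (\<bar>coeff f n\<bar> * x ^ n))"
        by (intro sum_mono) auto
      also have "\<dots> = q * C * (\<Sum>n\<in>{..degree f} - {k}. \<bar>coeff f n\<bar> * x ^ n)"
        by (simp add: sum_distrib_left)
      also have "\<dots> \<le> q * C * (\<bar>coeff f k\<bar> * x ^ k)"
        using x q C by (intro mult_left_mono) auto
      also have "\<dots> < 1 * (C * (\<bar>coeff f k\<bar> * x ^ k))"
        unfolding mult.assoc using x q C nz by (intro mult_strict_right_mono) auto
      \<comment> \<open>Evaluating at \<open>x / r\<close> divides the \<open>n\<close>-th term by
        \<open>r ^ n\<close>, which produces the quotients estimated above.\<close>
      finally show "\<exists>x>0. (\<Sum>n\<in>{..degree g} - {k}. \<bar>coeff g n\<bar> * x ^ n) < \<bar>coeff g k\<bar> * x ^ k"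
        using x(1) r(1) unfolding deg coeff
        by (intro exI[of _ "x / r"]) (simp add: C_def power_divide mult_ac)
    qed
    then show "real_rooted (diag_op (\<lambda>n. q ^ n\<^sup>2) (diag_op \<epsilon> (diag_op \<gamma> f)))"
      by (simp add: g_def)
  qed
qed

section \<open>Necessity of log-concavity through quadratic polynomials\<close>

lemma real_rooted_monom: "c \<noteq> 0 \<Longrightarrow> real_rooted (monom c n)"
  by (auto simp: real_rooted_def map_poly_monom poly_monom)

lemma real_rooted_quadratic_iff:
  assumes "a \<noteq> 0"
  shows "real_rooted [:c, b, a:] \<longleftrightarrow> 4 * a * c \<le> b\<^sup>2"
proof -
  have eq: "poly (map_poly complex_of_real [:c, b, a:]) z = of_real c + of_real b * z + of_real a * z\<^sup>2" for z
    by (simp add: map_poly_pCons power2_eq_square algebra_simps)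
  show ?thesis
  proof
    assume rr: "real_rooted [:c, b, a:]"
    show "4 * a * c \<le> b\<^sup>2"
    proof (rule ccontr)
      assume neg: "\<not> ?thesis"
      \<comment> \<open>The quadratic formula for a negative discriminant gives a nonreal
        zero.\<close>
      define z where "z = Complex (- b / (2 * a)) (sqrt (4 * a * c - b\<^sup>2) / (2 * a))"
      have "(sqrt (4 * a * c - b\<^sup>2))\<^sup>2 = 4 * a * c - b\<^sup>2"
        using neg by simp
      then have "of_real c + of_real b * z + of_real a * z\<^sup>2 = 0"
        using assms by (simp add: z_def complex_eq_iff power2_eq_square field_simps)
      then have "Im z = 0"
        using rr eq by (auto simp: real_rooted_def complex_is_Real_iff)
      with neg assms show False
        by (simp add: z_def)
    qed
  next
    assume disc: "4 * a * c \<le> b\<^sup>2"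
    show "real_rooted [:c, b, a:]"
      unfolding real_rooted_def
    proof (intro allI impI)
      fix z assume "poly (map_poly complex_of_real [:c, b, a:]) z = 0"
      then have z: "of_real c + of_real b * z + of_real a * z\<^sup>2 = 0"
        by (simp only: eq)
      have "(2 * of_real a * z + of_real b)\<^sup>2
          = 4 * of_real a * (of_real c + of_real b * z + of_real a * z\<^sup>2) + of_real (b\<^sup>2 - 4 * a * c)"
        by (simp add: power2_eq_square algebra_simps)
      with z have sq: "(2 * of_real a * z + of_real b)\<^sup>2 = of_real (b\<^sup>2 - 4 * a * c)"
        by simp
      \<comment> \<open>The square of \<open>w\<close> is the discriminant, a nonnegative real, so
        \<open>w\<close> is real; then so is \<open>z\<close>, as
        \<open>a \<noteq> 0\<close>.\<close>
      define w where "w = 2 * of_real a * z + of_real b"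
      have "Re w * Im w = 0" "(Re w)\<^sup>2 - (Im w)\<^sup>2 \<ge> 0"
        using sq disc unfolding w_def[symmetric] by (auto simp: complex_eq_iff power2_eq_square)
      then have "Im w = 0"
        by auto
      then show "z \<in> \<real>"
        using assms by (simp add: w_def complex_is_Real_iff)
    qed
  qed
qed

lemma preserves_imp_log_concave:
  assumes pos: "\<And>n. \<gamma> n > 0"
    and preserves: "\<And>f. sign_independently_real_rooted f \<Longrightarrow> sign_independently_real_rooted (diag_op \<gamma> f)"
  shows "log_concave \<gamma>"
  unfolding log_concave_def
proof (intro allI impI)
  fix n :: nat assume "1 \<le> n"
  then obtain k where n: "n = Suc k"
    by (cases n) auto
  \<comment> \<open>The discriminant of \<open>(1 + z)^2\<close> is zero, so its image is
    real-rooted exactly under the log-concavity inequality at \<open>k + 1\<close>. Sign changes are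
    harmless, since a product of two signs is at most 1, the square of a sign.\<close>
  define f :: "real poly" where "f = monom 1 k * [:1, 2, 1:]"
  have diag: "diag_op \<delta> f = monom 1 k * [:\<delta> k, 2 * \<delta> (k + 1), \<delta> (k + 2):]" for \<delta>
    by (auto simp: poly_eq_iff f_def coeff_monom_mult coeff_pCons less_diff_conv2 not_le split: nat.splits)
  have rr: "real_rooted (diag_op \<delta> f) \<longleftrightarrow> \<delta> (k + 2) * \<delta> k \<le> (\<delta> (k + 1))\<^sup>2" if "\<delta> (k + 2) \<noteq> 0" for \<delta>
    unfolding diag real_rooted_mult_iff real_rooted_quadratic_iff[OF that]
    by (simp add: real_rooted_monom power_mult_distrib)
  have "real_rooted (diag_op \<epsilon> f)" if "\<forall>n. \<epsilon> n \<in> {1, -1}" for \<epsilon>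
  proof (subst rr)
    have "\<epsilon> k \<in> {1, -1}" "\<epsilon> (k + 1) \<in> {1, -1}" "\<epsilon> (k + 2) \<in> {1, -1}"
      using that by blast+
    then show "\<epsilon> (k + 2) \<noteq> 0" "\<epsilon> (k + 2) * \<epsilon> k \<le> (\<epsilon> (k + 1))\<^sup>2"
      by auto
  qed
  then have "sign_independently_real_rooted (diag_op \<gamma> f)"
    by (intro preserves) (simp add: sign_independently_real_rooted_alt)
  then have "real_rooted (diag_op (\<lambda>_. 1) (diag_op \<gamma> f))"
    unfolding sign_independently_real_rooted_alt by simp
  then have "\<gamma> (k + 2) * \<gamma> k \<le> (\<gamma> (k + 1))\<^sup>2"
    unfolding diag_op_diag_op using rr[of \<gamma>] pos[of "k + 2"] by simp
  then show "\<gamma> (n - 1) * \<gamma> (n + 1) \<le> (\<gamma> n)\<^sup>2"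
    by (simp add: n mult.commute)
qed

theorem corollary1:
  fixes \<gamma> :: "nat \<Rightarrow> real"
  assumes "\<And>n. \<gamma> n > 0"
  shows "(\<forall>f. sign_independently_real_rooted f \<longrightarrow> sign_independently_real_rooted (diag_op \<gamma> f))
    \<longleftrightarrow> log_concave \<gamma>"
  using log_concave_imp_preserves[of \<gamma>] preserves_imp_log_concave[of \<gamma>] assms by blast

end
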